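(* Let $\mathcal{T}$ be a finite set with at least two threads and $\mathcal{X}$ a finite nonempty set of memory locations. For every integer $k\ge 1$, $\rightsquigarrow_s^{(k)}\ \subsetneq\ \rightsquigarrow_s^{(k+1)}$ as relations on $\Sigma^*$.
   Context: Given finite sets $\mathcal{T}$ (threads) and $\mathcal{X}$ (memory locations), let $\Sigma=\{\langle t,op(x)\rangle : t\in\mathcal{T},\ op\in\{\mathtt{w},\mathtt{r}\},\ x\in\mathcal{X}\}$ ($\mathtt{w}$ = write, $\mathtt{r}$ = read). A run is a finite word $\sigma\in\Sigma^*$; the occurrences of letters in it are its events. The reads-from map $\mathsf{rf}_\sigma$ is the partial map sending each read event on a location $x$ to the last write event on $x$ preceding it in $\sigma$, undefined if there is no such write. Reads-from equivalence: $\sigma\equiv_{\mathsf{rf}}\rho$ iff for every thread $t$ the subsequence of events of thread $t$ is the same in $\sigma$ and $\rho$ (same events and same program order; so the $j$-th event of thread $t$ in $\sigma$ is identified with the $j$-th event of thread $t$ in $\rho$), and, under this identification, $\mathsf{rf}_\sigma=\mathsf{rf}_\rho$. $k$-sliced reordering: $\sigma\rightsquigarrow_s^{(k)}\rho$ iff $\sigma\equiv_{\mathsf{rf}}\rho$ and the events of $\sigma$ can be partitioned into $k+1$ disjoint (possibly empty) subsequences $\sigma_1,\dots,\sigma_{k+1}$ of $\sigma$ such that $\rho=\sigma_1\cdot\sigma_2\cdots\sigma_{k+1}$ as sequences of events (identifying, for every thread $t$ and every $j$, the $j$-th event of thread $t$ in $\sigma$ with the $j$-th event of thread $t$ in $\rho$).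 *)

theory Defs
  imports Main "HOL-Library.Disjoint_Sets"
begin

datatype access = Wr | Rd

datatype ('t, 'x) letter = Letter (thread: 't) (acc: access) (loc: 'x)

type_synonym ('t, 'x) run = "('t, 'x) letter list"

definition alphabet :: "'t set \<Rightarrow> 'x set \<Rightarrow> ('t, 'x) letter set" where
  "alphabet T X = {Letter t a x | t a x. t \<in> T \<and> x \<in> X}"

text \<open>The event at position \<open>i\<close> of a run is named by its thread \<open>t\<close> together with its index
  (counted from 0) among the events of \<open>t\<close>. Two events of different runs are identified iff they
  have the same name; distinct positions of one run have distinct names.\<close>

definition event :: "('t, 'x) run \<Rightarrow> nat \<Rightarrow> 't \<times> nat" where
  "event \<sigma> i = (thread (\<sigma> ! i), card {j. j < i \<and> thread (\<sigma> ! j) = thread (\<sigma> ! i)})"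

definition events :: "('t, 'x) run \<Rightarrow> ('t \<times> nat) list" where
  "events \<sigma> = map (event \<sigma>) [0..<length \<sigma>]"

definition earlier_writes :: "('t, 'x) run \<Rightarrow> nat \<Rightarrow> nat set" where
  "earlier_writes \<sigma> i = {j. j < i \<and> acc (\<sigma> ! j) = Wr \<and> loc (\<sigma> ! j) = loc (\<sigma> ! i)}"

definition rf_pos :: "('t, 'x) run \<Rightarrow> nat \<Rightarrow> nat option" where
  "rf_pos \<sigma> i =
     (if i < length \<sigma> \<and> acc (\<sigma> ! i) = Rd \<and> earlier_writes \<sigma> i \<noteq> {}
      then Some (Max (earlier_writes \<sigma> i)) else None)"

text \<open>The graph of the reads-from partial map, on event names rather than positions, so that
  equality of graphs of different runs is equality of the maps under the identification of
  events.\<close>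

definition rf :: "('t, 'x) run \<Rightarrow> (('t \<times> nat) \<times> ('t \<times> nat)) set" where
  "rf \<sigma> = {(event \<sigma> i, event \<sigma> j) | i j. rf_pos \<sigma> i = Some j}"

definition thread_proj :: "'t \<Rightarrow> ('t, 'x) run \<Rightarrow> ('t, 'x) run" where
  "thread_proj t \<sigma> = filter (\<lambda>e. thread e = t) \<sigma>"

definition rf_equiv :: "('t, 'x) run \<Rightarrow> ('t, 'x) run \<Rightarrow> bool" where
  "rf_equiv \<sigma> \<rho> \<longleftrightarrow> (\<forall>t. thread_proj t \<sigma> = thread_proj t \<rho>) \<and> rf \<sigma> = rf \<rho>"

text \<open>\<open>S i\<close> is the set of positions in \<open>\<sigma>\<close> of the events of the \<open>i\<close>-th slice, and
  \<open>nths (events \<sigma>) (S i)\<close> is that slice as a subsequence of \<open>\<sigma>\<close>.\<close>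

definition sliced_reordering :: "'t set \<Rightarrow> 'x set \<Rightarrow> nat \<Rightarrow> (('t, 'x) run \<times> ('t, 'x) run) set" where
  "sliced_reordering T X k =
     {(\<sigma>, \<rho>). \<sigma> \<in> lists (alphabet T X) \<and> \<rho> \<in> lists (alphabet T X) \<and> rf_equiv \<sigma> \<rho> \<and>
        (\<exists>S :: nat \<Rightarrow> nat set.
           disjoint_family_on S {1..k + 1} \<and> (\<Union>i\<in>{1..k + 1}. S i) = {..<length \<sigma>} \<and>
           events \<rho> = concat (map (\<lambda>i. nths (events \<sigma>) (S i)) [1..<k + 2]))}"

end

theory Submission imports Defs begin

text \<open>Slices are increasing in the order of \<open>\<sigma>\<close>, so a concatenation of \<open>m\<close> of them has at most
  \<open>m - 1\<close> descents with respect to that order. Take two threads \<open>a\<close>, \<open>b\<close> that only read, which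
  makes the reads-from map empty and all interleavings equivalent: reordering \<open>(a b)\<^sup>n\<close> into
  \<open>(b a)\<^sup>n\<close> creates exactly \<open>n\<close> descents. With \<open>n = k + 1\<close> this needs \<open>k + 2\<close> slices, and the
  slices \<open>b\<^sub>0\<close>, \<open>a\<^sub>0 b\<^sub>1\<close>, \<open>a\<^sub>1 b\<^sub>2\<close>, \<dots>, \<open>a\<^sub>k\<close> suffice.\<close>

fun descents :: "'a::linorder list \<Rightarrow> nat" where
  "descents (x # y # zs) = (if y < x then 1 else 0) + descents (y # zs)"
| "descents _ = 0"

text \<open>The only new adjacent pair lies at the junction of \<open>xs\<close> and
  \<open>ys\<close>, which accounts for the \<open>1\<close>.\<close>

lemma descents_append_le: "descents (xs @ ys) \<le> descents xs + 1 + descents ys"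
proof (induction xs rule: descents.induct)
  case ("2_2" x)
  then show ?case by (cases ys) auto
qed auto

lemma descents_sorted: "sorted xs \<Longrightarrow> descents xs = 0"
  by (induction xs rule: descents.induct) auto

text \<open>Sorted blocks have no inner descents, so only the junctions count, and there is one
  fewer junction than blocks.\<close>

lemma descents_concat_sorted:
  assumes "\<forall>xs \<in> set xss. sorted xs" "xss \<noteq> []"
  shows "descents (concat xss) < length xss"
  using assms(2,1)
proof (induction xss rule: list_nonempty_induct)
  case (single xs)
  then show ?case by (simp add: descents_sorted)
next
  case (cons xs xss)
  then show ?case
    using descents_append_le[of xs "concat xss"] by (simp add: descents_sorted)
qed

lemma nths_Int_lessThan: "nths xs (A \<inter> {..<length xs}) = nths xs A"
  unfolding nths_def by (auto intro!: arg_cong[where f = "map fst"] filter_cong dest!: set_zip_rightD)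

lemma sliced_reordering_mono: "sliced_reordering T X k \<subseteq> sliced_reordering T X (k + 1)"
proof clarify
  fix \<sigma> \<rho> :: "('a, 'b) run"
  assume "(\<sigma>, \<rho>) \<in> sliced_reordering T X k"
  then obtain S where A: "\<sigma> \<in> lists (alphabet T X)" "\<rho> \<in> lists (alphabet T X)" "rf_equiv \<sigma> \<rho>"
    and disj: "disjoint_family_on S {1..k + 1}" and un: "(\<Union>i\<in>{1..k + 1}. S i) = {..<length \<sigma>}"
    and eq: "events \<rho> = concat (map (\<lambda>i. nths (events \<sigma>) (S i)) [1..<k + 2])"
    unfolding sliced_reordering_def by blast
  \<comment> \<open>The additional last slice is empty. It is overwritten explicitly because nothing
    is known about \<open>S\<close> outside \<open>{1..k + 1}\<close>.\<close>
  define S' where "S' = S(k + 2 := {})"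
  have "disjoint_family_on S' {1..k + 1 + 1}"
  proof -
    have "disjoint_family_on S' {1..k + 1}"
      using disj by (simp add: S'_def disjoint_family_on_def)
    then have "disjoint_family_on S' (insert (k + 2) {1..k + 1})"
      by (simp add: S'_def disjoint_family_on_insert)
    moreover have "insert (k + 2) {1..k + 1} = {1..k + 1 + 1}"
      by auto
    ultimately show ?thesis
      by simp
  qed
  moreover have "(\<Union>i\<in>{1..k + 1 + 1}. S' i) = (\<Union>i\<in>{1..k + 1}. S i)"
    unfolding S'_def by (auto simp: le_Suc_eq split: if_splits)
  moreover have "events \<rho> = concat (map (\<lambda>i. nths (events \<sigma>) (S' i)) [1..<k + 1 + 2])"
  proof -
    have "[1..<k + 1 + 2] = [1..<k + 2] @ [k + 2]"
      by simp
    moreover have "map (\<lambda>i. nths (events \<sigma>) (S' i)) [1..<k + 2]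
        = map (\<lambda>i. nths (events \<sigma>) (S i)) [1..<k + 2]"
      by (intro map_cong) (auto simp: S'_def)
    moreover have "S' (k + 2) = {}"
      by (simp add: S'_def)
    ultimately show ?thesis
      using eq by (simp only: map_append concat_append list.map concat.simps nths_empty append_Nil2)
  qed
  ultimately show "(\<sigma>, \<rho>) \<in> sliced_reordering T X (k + 1)"
    using A un unfolding sliced_reordering_def
    by (auto intro!: exI[of _ S'] simp del: upt_Suc)
qed

lemma event_append: "i < length \<sigma> \<Longrightarrow> event (\<sigma> @ \<tau>) i = event \<sigma> i"
  unfolding event_def by (auto simp: nth_append intro!: arg_cong[where f = card])

lemma event_snoc:
  "event (\<sigma> @ [e]) (length \<sigma>) = (thread e, length (thread_proj (thread e) \<sigma>))"
  unfolding event_def thread_proj_def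
  by (auto simp: nth_append length_filter_conv_card intro!: arg_cong[where f = card])

lemma events_snoc:
  "events (\<sigma> @ [e]) = events \<sigma> @ [(thread e, length (thread_proj (thread e) \<sigma>))]"
  unfolding events_def by (simp add: event_append event_snoc)

fun alternate :: "'t \<Rightarrow> 't \<Rightarrow> 'x \<Rightarrow> nat \<Rightarrow> ('t, 'x) run" where
  "alternate a b x 0 = []"
| "alternate a b x (Suc n) = (alternate a b x n @ [Letter a Rd x]) @ [Letter b Rd x]"

lemma length_alternate [simp]: "length (alternate a b x n) = 2 * n"
  by (induction n) auto

lemma set_alternate: "set (alternate a b x n) \<subseteq> {Letter a Rd x, Letter b Rd x}"
  by (induction n) auto

lemma rf_reads_only:
  assumes "\<forall>e \<in> set \<sigma>. acc e = Rd"
  shows "rf \<sigma> = {}"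
  using assms unfolding rf_def rf_pos_def earlier_writes_def
  by (fastforce split: if_splits dest: nth_mem)

lemma thread_proj_alternate:
  "a \<noteq> b \<Longrightarrow> thread_proj t (alternate a b x n) =
     (if t = a \<or> t = b then replicate n (Letter t Rd x) else [])"
  by (induction n) (auto simp: thread_proj_def replicate_append_same)

lemma rf_equiv_alternate:
  fixes a b :: 't
  assumes "a \<noteq> b"
  shows "rf_equiv (alternate a b x n) (alternate b a x n)"
proof -
  have "rf (alternate c d x n) = {}" for c d :: 't
    using set_alternate by (intro rf_reads_only) fastforce
  then show ?thesis
    using assms by (simp add: rf_equiv_def thread_proj_alternate)
qed

lemma events_alternate_Suc:
  assumes "a \<noteq> b"
  shows "events (alternate a b x (Suc n)) = events (alternate a b x n) @ [(a, n), (b, n)]"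
proof -
  have "thread_proj b (\<sigma> @ [Letter a Rd x]) = thread_proj b \<sigma>" for \<sigma>
    using assms by (simp add: thread_proj_def)
  then show ?thesis
    \<comment> \<open>Without reassociation the word stays two nested one-letter appends, so
      \<open>events_snoc\<close> applies twice.\<close>
    using assms by (simp add: events_snoc thread_proj_alternate del: append_assoc)
qed

lemma length_events [simp]: "length (events \<sigma>) = length \<sigma>"
  by (simp add: events_def)

text \<open>The position of an event in \<open>alternate a b x n\<close>, for every \<open>n\<close>
  large enough to contain it. Turning names into numbers makes descents meaningful.\<close>

definition alternate_pos :: "'t \<Rightarrow> 't \<times> nat \<Rightarrow> nat" where
  "alternate_pos a = (\<lambda>(t, j). if t = a then 2 * j else 2 * j + 1)"

lemma map_alternate_pos_events:
  "a \<noteq> b \<Longrightarrow> map (alternate_pos a) (events (alternate a b x n)) = [0..<2 * n]"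
proof (induction n)
  case 0
  then show ?case by (simp add: events_def)
next
  case (Suc n)
  then show ?case
    by (simp add: events_alternate_Suc alternate_pos_def del: alternate.simps)
qed

text \<open>A lower bound suffices, so a possible descent from the end of \<open>xs\<close> to
  \<open>y\<close> is ignored.\<close>

lemma descents_snoc:
  "descents (xs @ [y, z]) \<ge> descents xs + (if z < y then 1 else 0)"
  by (induction xs rule: descents.induct) auto

text \<open>Each block lists \<open>(b, j)\<close> before \<open>(a, j)\<close>, that is, position
  \<open>2 * j + 1\<close> before \<open>2 * j\<close>, and so contributes a descent.\<close>

lemma descents_events_swapped:
  "a \<noteq> b \<Longrightarrow> descents (map (alternate_pos a) (events (alternate b a x n))) \<ge> n"
proof (induction n)
  case (Suc n)
  then show ?case
    using descents_snoc[of "map (alternate_pos a) (events (alternate b a x n))"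
        "alternate_pos a (a, n)" "alternate_pos a (b, n)"]
    by (simp add: events_alternate_Suc alternate_pos_def del: alternate.simps)
qed simp

lemma alternate_not_sliced:
  assumes "a \<noteq> b"
  shows "(alternate a b x (k + 1), alternate b a x (k + 1)) \<notin> sliced_reordering T X k"
    (is "(?\<sigma>, ?\<rho>) \<notin> _")
proof
  let ?p = "map (alternate_pos a)"
  assume "(?\<sigma>, ?\<rho>) \<in> sliced_reordering T X k"
  then obtain S where "events ?\<rho> = concat (map (\<lambda>i. nths (events ?\<sigma>) (S i)) [1..<k + 2])"
    unfolding sliced_reordering_def by blast
  \<comment> \<open>Renaming events to positions commutes with slicing, so every slice becomes a
    sublist of an interval and is sorted.\<close>
  then have "?p (events ?\<rho>) = concat (map (\<lambda>i. nths (?p (events ?\<sigma>)) (S i)) [1..<k + 2])"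
    by (simp only: map_concat map_map nths_map o_def)
  also have "?p (events ?\<sigma>) = [0..<2 * (k + 1)]"
    using assms by (rule map_alternate_pos_events)
  finally have eq: "?p (events ?\<rho>) = concat (map (\<lambda>i. nths [0..<2 * (k + 1)] (S i)) [1..<k + 2])" .
  have "descents (?p (events ?\<rho>)) < length (map (\<lambda>i. nths [0..<2 * (k + 1)] (S i)) [1..<k + 2])"
    unfolding eq by (rule descents_concat_sorted) (auto simp: sorted_nths simp del: upt_Suc)
  then show False
    using descents_events_swapped[OF assms, of "k + 1" x] by (simp del: alternate.simps upt_Suc)
qed

text \<open>Slices are numbered from 1: \<open>(b, j)\<close> at position \<open>2 * j + 1\<close>
  goes to slice \<open>j + 1\<close>, and \<open>(a, j)\<close> at position \<open>2 * j\<close> to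
  slice \<open>j + 2\<close>.\<close>

definition alternate_slice :: "nat \<Rightarrow> nat" where
  "alternate_slice j = (if even j then j div 2 + 2 else j div 2 + 1)"

lemma nths_events_alternate:
  assumes "a \<noteq> b"
  shows "nths (events (alternate a b x n)) {j. alternate_slice j = i} =
    (if 2 \<le> i \<and> i < n + 2 then [(a, i - 2)] else []) @ (if 1 \<le> i \<and> i \<le> n then [(b, i - 1)] else [])"
proof (induction n)
  case 0
  then show ?case by (simp add: events_def)
next
  case (Suc n)
  \<comment> \<open>The last block starts at position \<open>2 * n\<close>, hence the shift.\<close>
  have "nths [(a, n), (b, n)] {j. alternate_slice (j + 2 * n) = i}
      = (if i = n + 2 then [(a, n)] else []) @ (if i = n + 1 then [(b, n)] else [])"
    by (auto simp: nths_Cons alternate_slice_def)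
  with Suc assms show ?case
    by (auto simp: events_alternate_Suc nths_append simp del: alternate.simps)
qed

text \<open>Invariant of the induction: the first \<open>m + 1\<close> slices complete
  \<open>m\<close> swapped blocks and already emit \<open>(b, m)\<close>, whose partner
  \<open>(a, m)\<close> opens the next slice. At \<open>m = n\<close> nothing is left over.\<close>

lemma concat_slices_alternate:
  assumes "a \<noteq> b" "m \<le> n"
  shows "concat (map (\<lambda>i. nths (events (alternate a b x n)) {j. alternate_slice j = i}) [1..<m + 2])
    = events (alternate b a x m) @ (if m < n then [(b, m)] else [])"
  using assms(2)
proof (induction m)
  case 0
  then show ?case
    using assms(1) nths_events_alternate[OF assms(1), of x n 1]
    by (simp add: events_def[of "[]"])
next
  case (Suc m)
  have "[1..<Suc m + 2] = [1..<m + 2] @ [m + 2]" by simp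
  with Suc assms(1) show ?case
    by (simp add: events_alternate_Suc nths_events_alternate del: alternate.simps upt_Suc)
qed

lemma alternate_sliced:
  assumes "a \<noteq> b" "a \<in> T" "b \<in> T" "x \<in> X"
  shows "(alternate a b x k, alternate b a x k) \<in> sliced_reordering T X k"
    (is "(?\<sigma>, ?\<rho>) \<in> _")
proof -
  \<comment> \<open>The cut is needed because the slices must cover exactly the positions of the
    run; \<open>nths\<close> does not see it.\<close>
  define S where "S i = {j. alternate_slice j = i} \<inter> {..<length ?\<sigma>}" for i
  have "?\<sigma> \<in> lists (alphabet T X)" "?\<rho> \<in> lists (alphabet T X)"
    using set_alternate[of a b x k] set_alternate[of b a x k] assms by (auto simp: alphabet_def)
  moreover have "disjoint_family_on S {1..k + 1}"
    by (auto simp: disjoint_family_on_def S_def)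
  moreover have "alternate_slice j \<in> {1..k + 1}" if "j < length ?\<sigma>" for j
    using that by (auto simp: alternate_slice_def elim!: evenE oddE)
  then have "(\<Union>i\<in>{1..k + 1}. S i) = {..<length ?\<sigma>}"
    by (auto simp: S_def)
  moreover have "nths (events ?\<sigma>) (S i) = nths (events ?\<sigma>) {j. alternate_slice j = i}" for i
    using nths_Int_lessThan[of "events ?\<sigma>"] by (simp add: S_def)
  then have eq: "events ?\<rho> = concat (map (\<lambda>i. nths (events ?\<sigma>) (S i)) [1..<k + 2])"
    using concat_slices_alternate[OF assms(1) order.refl, of x k] by (simp del: alternate.simps upt_Suc)
  ultimately show ?thesis
    using rf_equiv_alternate[OF assms(1)] eq
    unfolding sliced_reordering_def by (auto intro!: exI[of _ S] simp del: upt_Suc)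
qed

theorem proposition5p2:
  fixes T :: "'t set" and X :: "'x set" and k :: nat
  assumes "finite T" and "card T \<ge> 2"
    and "finite X" and "X \<noteq> {}"
    and "k \<ge> 1"
  shows "sliced_reordering T X k \<subset> sliced_reordering T X (k + 1)"
proof -
  obtain a b where "a \<in> T" "b \<in> T" "a \<noteq> b"
    using assms(2) by (metis card_2_iff obtain_subset_with_card_n insert_subset)
  moreover obtain x where "x \<in> X"
    using assms(4) by blast
  ultimately show ?thesis
    \<comment> \<open>Both facts concern the same pair of words with \<open>k + 1\<close> blocks,
      which separates the two relations.\<close>
    using alternate_sliced[of a b T x X "k + 1"] alternate_not_sliced[of a b x k T X]
      sliced_reordering_mono[of T X k] by (metis psubsetI)
qed

end
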